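(* Let $T:\mathbb{Z}_{>0}\to\mathbb{Z}_{>0}$ be defined by $T(n)=(3n+1)/2$ if $n$ is odd and $T(n)=n/2$ if $n$ is even. Assume the Lower Bound Hypothesis (LBH): there is a real constant $C\ge 0$ such that for all positive integers $j$ and $n$, not both equal to $1$, $$n\ge j^{-C}\cdot 2^{\left(1-H(q/j)\right)j},$$ where $q$ is the number of odd integers among $n,T(n),\ldots,T^{(j-1)}(n)$. Then, for integers $n\ge 2$, as $n\to\infty$, $$\sigma_\infty(n)\le \gamma_H\log n+O(\log\log n)\quad\text{and}\quad \log t(n)\le 2\log n+O(\log\log n),$$ where $\gamma_H=(\log 2-r_H\log 3)^{-1}=41.677647655\ldots$ and $r_H=0.609089\ldots$ is the unique non-zero real number satisfying $H(r_H)\log 2=r_H\log 3$.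
   Context: $T^{(k)}$ denotes the $k$-th iterate of $T$ (with $T^{(0)}$ the identity). $H$ is the binary entropy function $H(x)=-x\log_2 x-(1-x)\log_2(1-x)$ on $[0,1]$, extended by continuity with $H(0)=H(1)=0$. The total stopping time $\sigma_\infty(n)$ is the least $j\ge 0$ with $T^{(j)}(n)=1$ (set to $\infty$ if none exists), and the maximum excursion $t(n)=\sup_{k\ge 0}T^{(k)}(n)$ (possibly $\infty$). $\log$ is the natural logarithm. *)

theory Defs
  imports Complex_Main "HOL-Library.Extended_Real" "HOL-Library.Landau_Symbols"
begin

(* The map acts on positive integers; on nat it maps positive numbers to positive
   numbers, and the junk value at 0 is never used. *)
definition T :: "nat \<Rightarrow> nat" where
  "T n = (if odd n then (3 * n + 1) div 2 else n div 2)"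

lemma T_pos: "n > 0 \<Longrightarrow> T n > 0"
  by (auto simp: T_def elim!: evenE)

definition H :: "real \<Rightarrow> real" where
  "H x = (if x = 0 \<or> x = 1 then 0 else - x * log 2 x - (1 - x) * log 2 (1 - x))"

definition odd_count :: "nat \<Rightarrow> nat \<Rightarrow> nat" where
  "odd_count j n = card {i. i < j \<and> odd ((T ^^ i) n)}"

definition LBH :: bool where
  "LBH \<longleftrightarrow> (\<exists>C::real. C \<ge> 0 \<and> (\<forall>j n :: nat. j > 0 \<longrightarrow> n > 0 \<longrightarrow> \<not> (j = 1 \<and> n = 1) \<longrightarrow>
     real n \<ge> real j powr (- C) * 2 powr ((1 - H (real (odd_count j n) / real j)) * real j)))"

(* The infimum of the empty set is the top element of enat, i.e. infinity. *)
definition total_stopping_time :: "nat \<Rightarrow> enat" where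
  "total_stopping_time n = (INF j \<in> {j. (T ^^ j) n = 1}. enat j)"

definition max_excursion :: "nat \<Rightarrow> enat" where
  "max_excursion n = (SUP k. enat ((T ^^ k) n))"

definition ln_enat :: "enat \<Rightarrow> ereal" where
  "ln_enat x = (case x of enat m \<Rightarrow> ereal (ln (real m)) | \<infinity> \<Rightarrow> \<infinity>)"

(* The interval is the domain of H. *)
definition is_r_H :: "real \<Rightarrow> bool" where
  "is_r_H r \<longleftrightarrow> r \<in> {0..1} \<and> r \<noteq> 0 \<and> H r * ln 2 = r * ln 3"

definition r_H :: real where
  "r_H = (THE r. is_r_H r)"

definition \<gamma>_H :: real where
  "\<gamma>_H = inverse (ln 2 - r_H * ln 3)"

end

theory Submission
  imports Defs "HOL-Real_Asymp.Real_Asymp" "HOL-Analysis.Harmonic_Numbers"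
begin

text \<open>
  After \<open>j\<close> steps with \<open>q = x j\<close> odd ones, \<open>T^j n = n (3^q / 2^j) \<Prod>(1 + 1/(3 m))\<close>, the product
  ranging over the odd iterates \<open>m\<close>. Before the first visit to 1 the iterates are distinct, so the
  product is at most \<open>\<Prod>(1 + 1/m) \<le> j + 1\<close>. Hence, up to \<open>O(log j)\<close>,
  \<open>0 \<le> log (T^j n) \<le> log n - j (log 2 - x log 3)\<close>, while the hypothesis says
  \<open>j (1 - H x) log 2 \<le> log n\<close>. The first bound decides if \<open>x \<le> r_H\<close>, the second if \<open>x > r_H\<close>, and at
  \<open>x = r_H\<close> both coefficients of \<open>j\<close> equal \<open>1 / \<gamma>_H\<close>. Adding the two bounds and using
  \<open>H x log 2 + x log 3 \<le> log 4\<close> gives \<open>log (T^j n) \<le> 2 log n\<close>. A cruder version of the same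
  dichotomy, not needing distinctness, first shows that 1 is reached in \<open>O(log n)\<close> steps, which
  turns \<open>O(log j)\<close> into \<open>O(log log n)\<close>.
\<close>

subsection \<open>The entropy function\<close>

text \<open>At the endpoints the special cases of \<open>H\<close> agree with the formula: one
  product has the factor 0, the other the factor \<open>ln 1\<close>.\<close>

lemma H_times_ln2: "H x * ln 2 = - x * ln x - (1 - x) * ln (1 - x)"
  by (auto simp: H_def log_def field_simps)

text \<open>Gibbs' inequality on two points: \<open>ln t \<le> t - 1\<close> bounds the two terms by
  \<open>a - x\<close> and \<open>x - a\<close>, which cancel.\<close>

lemma entropy_le_cross_entropy:
  assumes "0 \<le> x" "x \<le> 1" "0 < a" "a < 1"
  shows "H x * ln 2 \<le> - x * ln a - (1 - x) * ln (1 - a)"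
proof -
  have *: "y * ln b - y * ln y \<le> b - y" if "0 \<le> y" "0 < b" for y b :: real
  proof (cases "y = 0")
    case False
    with that have "y * ln (b / y) \<le> y * (b / y - 1)"
      by (intro mult_left_mono ln_le_minus_one) auto
    with that False show ?thesis by (simp add: ln_div algebra_simps)
  qed (use that in auto)
  show ?thesis
    using *[of x a] *[of "1 - x" "1 - a"] assms by (simp add: H_times_ln2)
qed

text \<open>The cross entropy against \<open>a\<close> is the tangent to the entropy at
  \<open>a\<close>; its slope \<open>ln (1 - a) - ln a\<close> is nonpositive for
  \<open>a \<ge> 1/2\<close>.\<close>

lemma H_antimono:
  assumes "1/2 \<le> a" "a < 1" "a \<le> x" "x \<le> 1"
  shows "H x \<le> H a"
proof -
  have "H x * ln 2 \<le> - x * ln a - (1 - x) * ln (1 - a)"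
    using assms by (intro entropy_le_cross_entropy) auto
  also have "\<dots> = H a * ln 2 - (x - a) * (ln a - ln (1 - a))"
    by (simp add: H_times_ln2 algebra_simps)
  also have "\<dots> \<le> H a * ln 2"
    using assms by simp
  finally show ?thesis by simp
qed

text \<open>The right side is the cross entropy against 3/4. This inequality is the source of the
  factor 2 in the excursion bound.\<close>

lemma H_le_ln4:
  assumes "0 \<le> x" "x \<le> 1"
  shows "H x * ln 2 \<le> 2 * ln 2 - x * ln 3"
proof -
  have "ln (4::real) = 2 * ln 2"
    using ln_realpow[of 2 2] by simp
  then show ?thesis
    using entropy_le_cross_entropy[OF assms, of "3/4"] by (simp add: ln_div algebra_simps)
qed

lemma H_4_7_less_1: "H (4/7) < 1"
proof -
  have "H (4/7) * ln 2 = - (4/7) * (ln 4 - ln 7) - (3/7) * (ln 3 - ln 7)"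
    by (simp add: H_times_ln2 ln_div)
  then have "7 * (H (4/7) * ln 2) = 7 * ln 7 - 4 * ln 4 - 3 * ln 3"
    by (simp add: field_simps)
  also have "\<dots> = ln (7 ^ 7) - ln (4 ^ 4) - ln (3 ^ 3)"
    using ln_realpow[of 7 7] ln_realpow[of 4 4] ln_realpow[of 3 3] by simp
  also have "\<dots> = ln (7 ^ 7 / 4 ^ 4 / 3 ^ 3)"
    using ln_mult[of 256 27] by (simp add: ln_div)
  \<comment> \<open>This is 7^7 = 823543 < 884736 = 2^7 * 4^4 * 3^3.\<close>
  also have "\<dots> < ln (2 ^ 7)"
    by (subst ln_less_cancel_iff) simp_all
  also have "\<dots> = 7 * ln 2"
    using ln_realpow[of 2 7] by simp
  finally show ?thesis by simp
qed

text \<open>The ratio has derivative \<open>ln (1 - x) / x^2 < 0\<close>. As \<open>r_H\<close> is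
  where it takes the value \<open>ln 3\<close>, strict decrease gives uniqueness.\<close>

lemma entropy_ratio_less:
  assumes "0 < a" "a < b" "b < 1"
  shows "H b * ln 2 / b < H a * ln 2 / a"
proof (rule DERIV_neg_imp_decreasing[OF assms(2)])
  fix x assume x: "a \<le> x" "x \<le> b"
  with assms have "0 < x" "x < 1" by auto
  then have "((\<lambda>x. - x * ln x - (1 - x) * ln (1 - x)) has_real_derivative ln (1 - x) - ln x) (at x)"
    by (auto intro!: derivative_eq_intros)
  from DERIV_divide[OF this DERIV_ident] \<open>0 < x\<close>
  have "((\<lambda>x. (- x * ln x - (1 - x) * ln (1 - x)) / x) has_real_derivative
      ((ln (1 - x) - ln x) * x - (- x * ln x - (1 - x) * ln (1 - x)) * 1) / (x * x)) (at x)"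
    by simp
  also have "((ln (1 - x) - ln x) * x - (- x * ln x - (1 - x) * ln (1 - x)) * 1) / (x * x) = ln (1 - x) / x\<^sup>2"
    by (simp add: power2_eq_square algebra_simps)
  finally have "((\<lambda>x. (- x * ln x - (1 - x) * ln (1 - x)) / x) has_real_derivative ln (1 - x) / x\<^sup>2) (at x)" .
  moreover have "ln (1 - x) / x\<^sup>2 < 0"
    using \<open>0 < x\<close> \<open>x < 1\<close> by (simp add: divide_neg_pos)
  ultimately show "\<exists>y. ((\<lambda>x. H x * ln 2 / x) has_real_derivative y) (at x) \<and> y < 0"
    unfolding H_times_ln2 by blast
qed

section \<open>The root of the entropy equation: uniqueness and localisation\<close>

lemma is_r_H_iff: "is_r_H r \<longleftrightarrow> 0 < r \<and> r < 1 \<and> H r * ln 2 / r = ln 3"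
proof (cases "r = 1")
  case True
  then show ?thesis by (simp add: is_r_H_def H_def)
next
  case False
  then show ?thesis by (auto simp: is_r_H_def divide_eq_eq mult.commute)
qed

lemma is_r_H_unique: "is_r_H r \<Longrightarrow> is_r_H s \<Longrightarrow> r = s"
  using entropy_ratio_less[of r s] entropy_ratio_less[of s r]
  by (cases r s rule: linorder_cases) (auto simp: is_r_H_iff)

lemma is_r_H_between:
  assumes "0 < a" "a < b" "b < 1" "H a * ln 2 > a * ln 3" "H b * ln 2 < b * ln 3"
  shows "\<exists>r. is_r_H r \<and> a < r \<and> r < b"
proof -
  have "\<exists>x\<ge>a. x \<le> b \<and> H x * ln 2 / x = ln 3"
  proof (rule IVT2')
    show "continuous_on {a..b} (\<lambda>x. H x * ln 2 / x)"
      unfolding H_times_ln2 using assms by (auto intro!: continuous_intros)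
  qed (use assms in \<open>auto simp: field_simps\<close>)
  then obtain x where x: "a \<le> x" "x \<le> b" "H x * ln 2 / x = ln 3" by blast
  moreover have "x \<noteq> a" "x \<noteq> b" using x assms by (auto simp: field_simps)
  ultimately show ?thesis using assms by (intro exI[of _ x]) (auto simp: is_r_H_iff)
qed

subsection \<open>Numerical bounds\<close>

text \<open>The series is \<open>ln x = 2 artanh y\<close> with
  \<open>y = (x - 1) / (x + 1)\<close>, its tail bounded by a geometric series; the number of terms
  is chosen for an error near 1e-16.\<close>

lemma ln2_bounds: "ln (2::real) \<in> {0.6931471805599452..0.6931471805599454}"
proof -
  have "ln (2::real) \<in> {\<Sum>k<18. 2*(1/3)^(2*k+1) / real (2*k+1)..
      (\<Sum>k<18. 2*(1/3)^(2*k+1) / real (2*k+1)) + 2 * ((1/3)^37/(1-(1/3)^2)/37)}"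
    using ln_approx_bounds[of 2 18] by simp
  then show ?thesis
    by (simp add: lessThan_nat_numeral power_divide)
qed

lemma ln3_bounds: "ln (3::real) \<in> {1.0986122886681096..1.0986122886681098}"
proof -
  have "ln (3::real) \<in> {\<Sum>k<26. 2*(1/2)^(2*k+1) / real (2*k+1)..
      (\<Sum>k<26. 2*(1/2)^(2*k+1) / real (2*k+1)) + 2 * ((1/2)^53/(1-(1/2)^2)/53)}"
    using ln_approx_bounds[of 3 26] by simp
  then show ?thesis
    by (simp add: lessThan_nat_numeral power_divide)
qed

text \<open>This and the next logarithm are those of 14/23 and 1 - 14/23 = 9/23 up to sign, the base
  points for \<open>ln r\<close> and \<open>ln (1 - r)\<close> near the root.\<close>

lemma ln_23_14_bounds: "ln (23/14::real) \<in> {0.4964368863138910..0.4964368863138911}"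
proof -
  have "ln (23/14::real) \<in> {\<Sum>k<12. 2*(9/37)^(2*k+1) / real (2*k+1)..
      (\<Sum>k<12. 2*(9/37)^(2*k+1) / real (2*k+1)) + 2 * ((9/37)^25/(1-(9/37)^2)/25)}"
    using ln_approx_bounds[of "23/14" 12] by simp
  then show ?thesis
    by (simp add: lessThan_nat_numeral power_divide)
qed

lemma ln_23_9_bounds: "ln (23/9::real) \<in> {0.9382696385929303..0.9382696385929304}"
proof -
  have "ln (23/9::real) \<in> {\<Sum>k<24. 2*(7/16)^(2*k+1) / real (2*k+1)..
      (\<Sum>k<24. 2*(7/16)^(2*k+1) / real (2*k+1)) + 2 * ((7/16)^49/(1-(7/16)^2)/49)}"
    using ln_approx_bounds[of "23/9" 24] by simp
  then show ?thesis
    by (simp add: lessThan_nat_numeral power_divide)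
qed

text \<open>
  Two rational approximations of the root, an intermediate fraction of its continued fraction
  expansion on either side. Both are close to 14/23, which makes the logarithms fast to compute.
\<close>
definition r_lo :: real where "r_lo = 2013666/3306025"
definition r_hi :: real where "r_hi = 2333912/3831803"

lemma entropy_r_lo: "- r_lo * ln r_lo - (1 - r_lo) * ln (1 - r_lo) > r_lo * ln 3"
proof -
  \<comment> \<open>The fractions in \<open>a\<close> and \<open>b\<close> are
    \<open>r_lo / (14/23)\<close> and \<open>(9/23) / (1 - r_lo)\<close>, so close to 1 that two
    terms of the series suffice.\<close>
  have a: "ln (23157159/23142175::real) \<le> 0.0006472663526061"
    using ln_approx_bounds[of "23157159/23142175" 2] by (simp add: lessThan_nat_numeral power_divide)
  have b: "ln (29754225/29724257::real) \<ge> 0.0010076922452695"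
    using ln_approx_bounds[of "29754225/29724257" 2] by (simp add: lessThan_nat_numeral power_divide)
  have "ln r_lo = ln (23157159/23142175) - ln (23/14)"
    using ln_mult[of r_lo "23/14"] by (simp add: r_lo_def)
  then have "ln r_lo \<le> 0.0006472663526061 - 0.4964368863138910"
    using a ln_23_14_bounds by simp
  moreover have "ln (1 - r_lo) = - ln (29754225/29724257) - ln (23/9)"
    using ln_mult[of "1 - r_lo" "29754225/29724257"] ln_mult[of "(1 - r_lo) * (29754225/29724257)" "23/9"]
    by (simp add: r_lo_def)
  then have "ln (1 - r_lo) \<le> - 0.0010076922452695 - 0.9382696385929303"
    using b ln_23_9_bounds by simp
  ultimately show ?thesis
    using ln3_bounds by (simp add: r_lo_def)
qed

lemma entropy_r_hi: "- r_hi * ln r_hi - (1 - r_hi) * ln (1 - r_hi) < r_hi * ln 3"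
proof -
  \<comment> \<open>The same factorisation at \<open>r_hi\<close>, with every estimate
    reversed.\<close>
  have a: "ln (3834284/3831803::real) \<ge> 0.0006472663528652"
    using ln_approx_bounds[of "3834284/3831803" 2] by (simp add: lessThan_nat_numeral power_divide)
  have b: "ln (11495409/11483831::real) \<le> 0.0010076922456734"
    using ln_approx_bounds[of "11495409/11483831" 2] by (simp add: lessThan_nat_numeral power_divide)
  have "ln r_hi = ln (3834284/3831803) - ln (23/14)"
    using ln_mult[of r_hi "23/14"] by (simp add: r_hi_def)
  then have "ln r_hi \<ge> 0.0006472663528652 - 0.4964368863138911"
    using a ln_23_14_bounds by simp
  moreover have "ln (1 - r_hi) = - ln (11495409/11483831) - ln (23/9)"
    using ln_mult[of "1 - r_hi" "11495409/11483831"] ln_mult[of "(1 - r_hi) * (11495409/11483831)" "23/9"]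
    by (simp add: r_hi_def)
  then have "ln (1 - r_hi) \<ge> - 0.0010076922456734 - 0.9382696385929304"
    using b ln_23_9_bounds by simp
  ultimately show ?thesis
    using ln3_bounds by (simp add: r_hi_def)
qed

text \<open>An error in \<open>r\<close> is amplified by about \<open>\<gamma>_H^2 * ln 3\<close>,
  roughly 1900; since \<open>r_hi - r_lo\<close> is about 1.6e-13, the result is still determined to
  within 1e-9.\<close>

lemma inverse_bounds:
  assumes "r_lo < r" "r < r_hi"
  shows "41.677647655 \<le> inverse (ln 2 - r * ln 3)" "inverse (ln 2 - r * ln 3) < 41.677647656"
proof -
  have "r_lo * ln 3 < r * ln 3" "r * ln 3 < r_hi * ln 3"
    using assms by simp_all
  then have 1: "ln 2 - r * ln 3 < ln 2 - r_lo * ln 3" "ln 2 - r * ln 3 > ln 2 - r_hi * ln 3"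
    by simp_all
  have 2: "ln 2 - r_lo * ln 3 \<le> 1 / 41.677647655" "ln 2 - r_hi * ln 3 > 1 / 41.677647656"
    using ln2_bounds ln3_bounds by (simp_all add: r_lo_def r_hi_def)
  define x where "x = ln 2 - r * ln 3"
  have "x \<le> 1 / 41.677647655" "1 / 41.677647656 < x"
    using 1 2 unfolding x_def by linarith+
  then have "x > 0" "41.677647655 \<le> inverse x" "inverse x < 41.677647656"
    by (auto simp: field_simps)
  then show "41.677647655 \<le> inverse (ln 2 - r * ln 3)" "inverse (ln 2 - r * ln 3) < 41.677647656"
    unfolding x_def by auto
qed

lemma ex_is_r_H: "\<exists>r. is_r_H r \<and> r_lo < r \<and> r < r_hi"
proof (rule is_r_H_between)
  show "0 < r_lo" "r_lo < r_hi" "r_hi < 1"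
    by (simp_all add: r_lo_def r_hi_def)
qed (use entropy_r_lo entropy_r_hi in \<open>simp_all add: H_times_ln2\<close>)

lemma is_r_H_r_H: "is_r_H r_H"
  unfolding r_H_def by (rule theI') (use ex_is_r_H is_r_H_unique in blast)

lemma r_H_between: "r_lo < r_H" "r_H < r_hi"
  using ex_is_r_H is_r_H_unique is_r_H_r_H by blast+

lemma gamma_H_bounds: "41.677647655 \<le> \<gamma>_H" "\<gamma>_H < 41.677647656"
  unfolding \<gamma>_H_def using r_H_between by (intro inverse_bounds; simp)+

subsection \<open>Trajectories\<close>

lemma odd_count_0 [simp]: "odd_count 0 n = 0"
  by (simp add: odd_count_def)

lemma odd_count_Suc:
  "odd_count (Suc j) n = odd_count j n + (if odd ((T ^^ j) n) then 1 else 0)"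
proof -
  have "{i. i < Suc j \<and> odd ((T ^^ i) n)} =
      (if odd ((T ^^ j) n) then insert j else id) {i. i < j \<and> odd ((T ^^ i) n)}"
    by (auto simp: less_Suc_eq)
  then show ?thesis by (simp add: odd_count_def)
qed

lemma odd_count_le: "odd_count j n \<le> j"
  by (induction j) (auto simp: odd_count_Suc)

lemma T_funpow_pos: "n > 0 \<Longrightarrow> (T ^^ j) n > 0"
  by (induction j) (auto simp: T_pos)

text \<open>An odd step multiplies \<open>m\<close> by \<open>(3/2) * (1 + 1 / (3 m))\<close>, an
  even one by 1/2.\<close>

lemma T_funpow_eq_prod:
  assumes "n > 0"
  shows "real ((T ^^ j) n) = real n * (3 ^ odd_count j n / 2 ^ j) *
    (\<Prod>i | i < j \<and> odd ((T ^^ i) n). 1 + 1 / (3 * real ((T ^^ i) n)))"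
proof (induction j)
  case (Suc j)
  let ?m = "(T ^^ j) n"
  have m: "?m > 0" using assms by (rule T_funpow_pos)
  let ?A = "\<lambda>j. {i. i < j \<and> odd ((T ^^ i) n)}"
  define f where "f = (\<lambda>i. 1 + 1 / (3 * real ((T ^^ i) n)))"
  have A: "?A (Suc j) = (if odd ?m then insert j (?A j) else ?A j)"
    by (auto simp: less_Suc_eq)
  have IH: "real ?m = real n * (3 ^ odd_count j n / 2 ^ j) * prod f (?A j)"
    using Suc.IH by (simp add: f_def)
  have "real (T ?m) = real n * (3 ^ odd_count (Suc j) n / 2 ^ Suc j) * prod f (?A (Suc j))"
  proof (cases "odd ?m")
    case True
    then obtain b where b: "?m = 2 * b + 1" by (elim oddE)
    then have "T ?m = 3 * b + 2" by (simp add: T_def)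
    with b have "real (T ?m) = (3 * real ?m + 1) / 2" by simp
    also have "\<dots> = real ?m * (3/2) * f j"
      using m by (simp add: f_def field_simps)
    also have "\<dots> = real n * (3 ^ odd_count j n / 2 ^ j) * prod f (?A j) * (3/2) * f j"
      by (simp only: IH)
    finally show ?thesis
      using True by (simp add: A odd_count_Suc mult_ac)
  next
    case False
    then have "real (T ?m) = real ?m / 2"
      by (simp add: T_def real_of_nat_div)
    then show ?thesis
      using False by (simp add: IH A odd_count_Suc)
  qed
  then show ?case by (simp add: f_def)
qed simp

text \<open>Adjoin elements in increasing order: the new maximum \<open>b\<close> is at least
  \<open>card A + 1\<close>, so the factor \<open>1 + 1 / b\<close> adds at most 1 to the bound. For
  \<open>S = {1..k}\<close> the product telescopes to equality.\<close>

lemma prod_one_plus_inverse_le: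
  assumes "finite S" "\<And>m. m \<in> S \<Longrightarrow> 0 < m"
  shows "(\<Prod>m\<in>S. 1 + 1 / real m) \<le> real (card S) + 1"
  using assms
proof (induction S rule: finite_linorder_max_induct)
  case (insert b A)
  have "A \<subseteq> {1..<b}"
    using insert by (auto simp: Suc_le_eq)
  then have "card A \<le> card {1..<b}"
    by (intro card_mono) auto
  moreover have "b > 0" using insert by simp
  ultimately have b: "real (card A) + 1 \<le> real b"
    by simp
  have "(\<Prod>m\<in>insert b A. 1 + 1 / real m) = (1 + 1 / real b) * (\<Prod>m\<in>A. 1 + 1 / real m)"
    using insert by (subst prod.insert) auto
  also have "\<dots> \<le> (1 + 1 / real b) * (real (card A) + 1)"
    using insert by (intro mult_left_mono) auto
  also have "\<dots> = real (card A) + 1 + (real (card A) + 1) / real b"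
    by (simp add: algebra_simps add_divide_distrib)
  also have "\<dots> \<le> real (card A) + 1 + 1"
    using b \<open>b > 0\<close> by (simp add: divide_le_eq)
  also have "\<dots> = real (card (insert b A)) + 1"
    using insert by (subst card_insert_disjoint) auto
  finally show ?case .
qed simp

lemma T_funpow_le_of_distinct:
  assumes "n > 0" "inj_on (\<lambda>i. (T ^^ i) n) {..<j}"
  shows "real ((T ^^ j) n) \<le> real n * (3 ^ odd_count j n / 2 ^ j) * (real j + 1)"
proof -
  let ?A = "{i. i < j \<and> odd ((T ^^ i) n)}"
  let ?t = "\<lambda>i. (T ^^ i) n"
  have inj: "inj_on ?t ?A" using assms(2) by (rule inj_on_subset) auto
  \<comment> \<open>Dropping the 3 costs only a power of \<open>j\<close>, which is a logarithmic
    error later.\<close>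
  have "(\<Prod>i\<in>?A. 1 + 1 / (3 * real (?t i))) \<le> (\<Prod>i\<in>?A. 1 + 1 / real (?t i))"
    using T_funpow_pos[OF assms(1)] by (intro prod_mono) (auto simp: field_simps)
  also have "\<dots> = (\<Prod>m\<in>?t ` ?A. 1 + 1 / real m)"
    using inj by (simp add: prod.reindex)
  also have "\<dots> \<le> real (card (?t ` ?A)) + 1"
    using T_funpow_pos[OF assms(1)] by (intro prod_one_plus_inverse_le) auto
  also have "\<dots> = real (odd_count j n) + 1"
    using inj by (simp add: card_image odd_count_def)
  also have "\<dots> \<le> real j + 1"
    using odd_count_le[of j n] by simp
  finally show ?thesis
    unfolding T_funpow_eq_prod[OF assms(1), of j] by (intro mult_left_mono) auto
qed

text \<open>An odd iterate other than 1 is at least 3, so each correction factor is at most 10/9,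
  and 3 * 10/9 = 10/3.\<close>

lemma T_funpow_le_of_avoids_1:
  assumes "n > 0" "\<And>i. i < j \<Longrightarrow> (T ^^ i) n \<noteq> 1"
  shows "real ((T ^^ j) n) \<le> real n * ((10/3) ^ odd_count j n / 2 ^ j)"
proof -
  let ?A = "{i. i < j \<and> odd ((T ^^ i) n)}"
  have "(\<Prod>i\<in>?A. 1 + 1 / (3 * real ((T ^^ i) n))) \<le> (\<Prod>i\<in>?A. 10/9)"
  proof (intro prod_mono conjI)
    fix i assume "i \<in> ?A"
    then have "(T ^^ i) n \<noteq> 1" "odd ((T ^^ i) n)" using assms(2) by auto
    then have "3 \<le> (T ^^ i) n" by (auto elim!: oddE)
    then show "1 + 1 / (3 * real ((T ^^ i) n)) \<le> 10/9" by (simp add: field_simps)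
  qed auto
  also have "\<dots> = (10/9) ^ odd_count j n"
    by (simp add: odd_count_def)
  finally have "real ((T ^^ j) n) \<le> real n * (3 ^ odd_count j n / 2 ^ j) * (10/9) ^ odd_count j n"
    unfolding T_funpow_eq_prod[OF assms(1), of j] by (intro mult_left_mono) auto
  also have "\<dots> = real n * ((3 * (10/9)) ^ odd_count j n / 2 ^ j)"
    unfolding power_mult_distrib by (simp only: ac_simps times_divide_eq_left times_divide_eq_right)
  finally show ?thesis by simp
qed

lemma T_funpow_from_1: "(T ^^ k) 1 \<le> 2"
proof -
  have "(T ^^ k) 1 \<in> {1, 2}"
    by (induction k) (auto simp: T_def)
  then show ?thesis by auto
qed

text \<open>Serves to absorb the loss \<open>C * ln j\<close> of the hypothesis into a term linear
  in \<open>j\<close>.\<close>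

lemma mult_ln_le_linear:
  fixes C \<delta> :: real
  assumes "C \<ge> 0" "\<delta> > 0"
  shows "\<exists>K\<ge>0. \<forall>x>0. C * ln x \<le> \<delta> * x + K"
proof (intro exI conjI allI impI)
  \<comment> \<open>The denominator \<open>C + 1\<close> stays positive when
    \<open>C = 0\<close>.\<close>
  define \<epsilon> where "\<epsilon> = \<delta> / (C + 1)"
  have \<epsilon>: "\<epsilon> > 0" "C * \<epsilon> \<le> \<delta>" using assms by (auto simp: \<epsilon>_def field_simps)
  show "0 \<le> C * \<bar>ln \<epsilon>\<bar>" using assms by simp
  fix x :: real assume x: "0 < x"
  have "ln x = ln (\<epsilon> * x) - ln \<epsilon>" using x \<epsilon> by (simp add: ln_mult)
  also have "\<dots> \<le> \<epsilon> * x + \<bar>ln \<epsilon>\<bar>"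
    using ln_le_minus_one[of "\<epsilon> * x"] abs_ge_minus_self[of "ln \<epsilon>"] x \<epsilon>
    by simp
  finally have "C * ln x \<le> C * (\<epsilon> * x + \<bar>ln \<epsilon>\<bar>)" using assms by (intro mult_left_mono)
  also have "\<dots> = (C * \<epsilon>) * x + C * \<bar>ln \<epsilon>\<bar>" by (simp add: algebra_simps)
  also have "\<dots> \<le> \<delta> * x + C * \<bar>ln \<epsilon>\<bar>" using x \<epsilon> by (intro add_right_mono mult_right_mono) auto
  finally show "C * ln x \<le> \<delta> * x + C * \<bar>ln \<epsilon>\<bar>" .
qed

subsection \<open>Consequences of the lower bound hypothesis\<close>

text \<open>A repetition before the first visit to 1 could be cut out, giving an earlier visit.\<close>
lemma inj_on_before_first_hit:
  assumes "(T ^^ s) n = 1" "\<forall>i<s. (T ^^ i) n \<noteq> 1"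
  shows "inj_on (\<lambda>i. (T ^^ i) n) {..<s}"
proof (rule linorder_inj_onI')
  fix a b assume ab: "a \<in> {..<s}" "b \<in> {..<s}" "a < b"
  show "(T ^^ a) n \<noteq> (T ^^ b) n"
  proof
    assume eq: "(T ^^ a) n = (T ^^ b) n"
    have "(T ^^ (s - b + a)) n = (T ^^ (s - b)) ((T ^^ a) n)" by (simp add: funpow_add)
    also have "\<dots> = (T ^^ (s - b + b)) n" by (simp add: eq funpow_add)
    also have "\<dots> = 1" using assms ab by simp
    finally show False using assms(2) ab by auto
  qed
qed

text \<open>The hypothesis with its constant fixed; \<open>n > 1\<close> rules out the exceptional
  pair \<open>j = n = 1\<close>.\<close>

locale collatz_lower_bound =
  fixes C :: real
  assumes C_nonneg: "C \<ge> 0"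
    and lower_bound: "\<And>j n. j > 0 \<Longrightarrow> n > 1 \<Longrightarrow>
      real n \<ge> real j powr (- C) * 2 powr ((1 - H (real (odd_count j n) / real j)) * real j)"
begin

lemma ln_lower_bound:
  assumes "j > 0" "n > 1"
  shows "real j * (1 - H (real (odd_count j n) / real j)) * ln 2 \<le> ln (real n) + C * ln (real j)"
proof -
  let ?e = "(1 - H (real (odd_count j n) / real j)) * real j"
  have "ln (real j powr (- C) * 2 powr ?e) \<le> ln (real n)"
    using assms lower_bound[OF assms] by (subst ln_le_cancel_iff) auto
  then show ?thesis
    using assms by (simp add: ln_mult ln_powr mult.commute mult.left_commute)
qed

text \<open>
  An odd step from a number other than 1 multiplies by at most \<open>(10/3)/2\<close>. The threshold 4/7 for
  the proportion of odd steps works because \<open>H(4/7) < 1\<close> and \<open>(10/3)^(4/7) < 2\<close>: above it the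
  hypothesis bounds the number of steps, below it the decay of the trajectory does.
\<close>
lemma steps_avoiding_1_bounded:
  "\<exists>A>0. \<forall>n j. n > 1 \<longrightarrow> (\<forall>i<j. (T ^^ i) n \<noteq> 1) \<longrightarrow> real j \<le> A * ln (real n)"
proof -
  \<comment> \<open>The smaller of the rates per step available above and below the threshold; the
    second is positive because (10/3)^4 < 2^7.\<close>
  define \<delta> where "\<delta> = min ((1 - H (4/7)) * ln 2) (ln 2 - 4/7 * ln (10/3))"
  have "4 * ln (10/3) = ln ((10/3 :: real) ^ 4)" by (simp add: ln_realpow del: power_divide)
  also have "\<dots> < ln (2 ^ 7)" by (subst ln_less_cancel_iff) (simp_all add: power_divide)
  also have "\<dots> = 7 * ln 2" using ln_realpow[of 2 7] by simp
  finally have \<delta>: "\<delta> > 0" using H_4_7_less_1 by (simp add: \<delta>_def)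
  obtain K where K: "K \<ge> 0" "\<And>x. x > 0 \<Longrightarrow> C * ln x \<le> \<delta> / 2 * x + K"
    using mult_ln_le_linear[OF C_nonneg, of "\<delta> / 2"] \<delta> by auto
  \<comment> \<open>Half of \<open>\<delta> * j\<close> survives the absorption of
    \<open>C * ln j\<close>, and \<open>n \<ge> 2\<close> turns the additive \<open>K\<close> into
    at most \<open>K / ln 2 * ln n\<close>.\<close>
  define A where "A = 2 / \<delta> * (1 + K / ln 2)"
  have "1 + K / ln 2 > 0" using K by (intro add_pos_nonneg) auto
  then have "A > 0" unfolding A_def using \<delta> by (intro mult_pos_pos) auto
  moreover have "real j \<le> A * ln (real n)"
    if n: "n > 1" and avoids: "\<forall>i<j. (T ^^ i) n \<noteq> 1" for n j
  proof (cases "j = 0")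
    case False
    define q where "q = odd_count j n"
    define x where "x = real q / real j"
    have x: "0 \<le> x" "x \<le> 1" "real q = x * real j"
      using False odd_count_le[of j n] by (auto simp: x_def q_def)
    have C_ln: "C * ln (real j) \<ge> 0" using C_nonneg False by simp
    have "\<delta> * real j \<le> ln (real n) + C * ln (real j)"
    proof (cases "x \<ge> 4/7")
      case True
      then have "H x \<le> H (4/7)" using x by (intro H_antimono) auto
      then have "(1 - H (4/7)) * ln 2 \<le> (1 - H x) * ln 2" by simp
      then have "\<delta> \<le> (1 - H x) * ln 2" by (simp add: \<delta>_def min_le_iff_disj)
      then have "\<delta> * real j \<le> (1 - H x) * ln 2 * real j" by (rule mult_right_mono) simp
      also have "\<dots> \<le> ln (real n) + C * ln (real j)"
        using ln_lower_bound[of j n] False n by (simp add: x_def q_def mult_ac)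
      finally show ?thesis .
    next
      case less: False
      have "1 \<le> real ((T ^^ j) n)" using T_funpow_pos[of n j] n by simp
      also have "\<dots> \<le> real n * ((10/3) ^ q / 2 ^ j)"
        unfolding q_def using avoids n by (intro T_funpow_le_of_avoids_1) auto
      finally have "ln 1 \<le> ln (real n * ((10/3) ^ q / 2 ^ j))"
        by (rule ln_mono) simp
      also have "\<dots> = ln (real n) + real q * ln (10/3) - real j * ln 2"
        using n by (simp add: ln_mult ln_div ln_realpow del: power_divide)
      finally have "real j * (ln 2 - x * ln (10/3)) \<le> ln (real n)"
        by (simp add: x(3) algebra_simps)
      moreover have "x * ln (10/3) \<le> 4/7 * ln (10/3)" using less by (intro mult_right_mono) auto
      then have "\<delta> \<le> ln 2 - x * ln (10/3)" by (simp add: \<delta>_def min_le_iff_disj)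
      then have "\<delta> * real j \<le> real j * (ln 2 - x * ln (10/3))"
        by (subst mult.commute, intro mult_left_mono) auto
      ultimately show ?thesis using C_ln by linarith
    qed
    also have "C * ln (real j) \<le> \<delta> / 2 * real j + K" using K(2)[of "real j"] False by simp
    finally have "\<delta> / 2 * real j \<le> ln (real n) + K" by (simp add: algebra_simps)
    also have "K \<le> K / ln 2 * ln (real n)"
      using K(1) n by (simp add: field_simps mult_left_mono)
    finally have "\<delta> / 2 * real j \<le> (1 + K / ln 2) * ln (real n)" by (simp add: algebra_simps)
    then have "2 / \<delta> * (\<delta> / 2 * real j) \<le> A * ln (real n)"
      unfolding A_def mult.assoc using \<delta> by (intro mult_left_mono) auto
    then show ?thesis using \<delta> by simp
  qed (use \<open>A > 0\<close> n in simp)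
  ultimately show ?thesis by blast
qed

text \<open>A trajectory avoiding 1 for more than \<open>A * ln n\<close> steps would contradict the
  previous bound.\<close>

lemma ex_first_hit:
  assumes "n > 1"
  shows "\<exists>s>0. (T ^^ s) n = 1 \<and> (\<forall>i<s. (T ^^ i) n \<noteq> 1)"
proof -
  obtain A where A: "\<And>j. (\<forall>i<j. (T ^^ i) n \<noteq> 1) \<Longrightarrow> real j \<le> A * ln (real n)"
    using steps_avoiding_1_bounded assms by blast
  obtain j :: nat where "real j > A * ln (real n)" using reals_Archimedean2 by blast
  with A[of j] have "\<exists>i. (T ^^ i) n = 1" by force
  then have "(T ^^ (LEAST i. (T ^^ i) n = 1)) n = 1" by (rule LeastI_ex)
  moreover have "\<forall>i<(LEAST i. (T ^^ i) n = 1). (T ^^ i) n \<noteq> 1" using not_less_Least by blast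
  moreover have "(LEAST i. (T ^^ i) n = 1) > 0" using assms calculation(1) by (intro gr0I) auto
  ultimately show ?thesis by blast
qed

lemma ln_T_funpow_le:
  assumes "n > 1" "inj_on (\<lambda>i. (T ^^ i) n) {..<j}"
  shows "ln (real ((T ^^ j) n)) \<le>
    ln (real n) + real (odd_count j n) * ln 3 - real j * ln 2 + ln (real j + 1)"
proof -
  have "real ((T ^^ j) n) > 0" using T_funpow_pos[of n j] assms by simp
  moreover have "real ((T ^^ j) n) \<le> real n * (3 ^ odd_count j n / 2 ^ j) * (real j + 1)"
    using assms by (intro T_funpow_le_of_distinct) auto
  ultimately have "ln (real ((T ^^ j) n)) \<le> ln (real n * (3 ^ odd_count j n / 2 ^ j) * (real j + 1))"
    by (intro ln_mono) auto
  also have "\<dots> = ln (real n) + real (odd_count j n) * ln 3 - real j * ln 2 + ln (real j + 1)"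
    using assms by (simp add: ln_mult ln_div ln_realpow)
  finally show ?thesis .
qed

lemma C_ln_le: "C * ln (real j) \<le> C * ln (real j + 1)"
  \<comment> \<open>At \<open>j = 0\<close> both sides vanish, as \<open>ln 0 = 0\<close> by
    convention.\<close>
  using C_nonneg by (cases "j = 0") (auto intro!: mult_left_mono)

lemma stopping_bound:
  assumes "n > 1" "inj_on (\<lambda>i. (T ^^ i) n) {..<j}"
  shows "real j \<le> \<gamma>_H * (ln (real n) + (C + 1) * ln (real j + 1))"
proof (cases "j = 0")
  case False
  define x where "x = real (odd_count j n) / real j"
  have x: "0 \<le> x" "x \<le> 1" "real (odd_count j n) = x * real j"
    using False odd_count_le[of j n] by (auto simp: x_def)
  let ?g = "ln 2 - r_H * ln 3"
  have g: "\<gamma>_H = inverse ?g" "\<gamma>_H > 0" by (rule \<gamma>_H_def) (use gamma_H_bounds in simp)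
  then have "?g > 0" by (metis inverse_positive_iff_positive)
  have nonneg: "C * ln (real j + 1) \<ge> 0" "ln (real j + 1) \<ge> 0" using C_nonneg by auto
  have "?g * real j \<le> ln (real n) + (C + 1) * ln (real j + 1)"
  proof (cases "x \<le> r_H")
    case True
    have "0 \<le> ln (real ((T ^^ j) n))" using T_funpow_pos[of n j] assms by simp
    with ln_T_funpow_le[OF assms]
    have "(ln 2 - x * ln 3) * real j \<le> ln (real n) + ln (real j + 1)"
      by (simp add: x(3) algebra_simps)
    moreover have "?g * real j \<le> (ln 2 - x * ln 3) * real j"
      using True by (intro mult_right_mono) auto
    ultimately show ?thesis using nonneg by (simp add: algebra_simps)
  next
    case gt: False
    \<comment> \<open>The monotonicity of \<open>H\<close> is available only to the right of
      1/2.\<close>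
    have "r_H \<ge> 1/2" "r_H < 1" using r_H_between by (auto simp: r_lo_def r_hi_def)
    then have "H x \<le> H r_H" using gt x by (intro H_antimono) auto
    then have "H x * ln 2 \<le> H r_H * ln 2" by simp
    also have "\<dots> = r_H * ln 3" using is_r_H_r_H by (simp add: is_r_H_def)
    finally have "?g \<le> (1 - H x) * ln 2" by (simp add: algebra_simps)
    then have "?g * real j \<le> (1 - H x) * ln 2 * real j" by (rule mult_right_mono) simp
    also have "\<dots> \<le> ln (real n) + C * ln (real j)"
      using ln_lower_bound[of j n] False assms by (simp add: x_def mult_ac)
    also have "\<dots> \<le> ln (real n) + (C + 1) * ln (real j + 1)"
      using C_ln_le[of j] nonneg unfolding distrib_right by linarith
    finally show ?thesis .
  qed
  then have "\<gamma>_H * (?g * real j) \<le> \<gamma>_H * (ln (real n) + (C + 1) * ln (real j + 1))"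
    using g by (intro mult_left_mono) auto
  moreover have "\<gamma>_H * ?g = 1" unfolding g(1) using \<open>?g > 0\<close> by (intro left_inverse) simp
  ultimately show ?thesis by (simp only: mult.assoc[symmetric] mult_1_left)
qed (use gamma_H_bounds assms in auto)

lemma excursion_bound:
  assumes "n > 1" "inj_on (\<lambda>i. (T ^^ i) n) {..<j}"
  shows "ln (real ((T ^^ j) n)) \<le> 2 * ln (real n) + (C + 1) * ln (real j + 1)"
proof (cases "j = 0")
  case False
  define x where "x = real (odd_count j n) / real j"
  have x: "0 \<le> x" "x \<le> 1" "real (odd_count j n) = x * real j"
    using False odd_count_le[of j n] by (auto simp: x_def)
  \<comment> \<open>The growth rate per step is at most the rate that the hypothesis charges against
    \<open>ln n\<close>, so all growth costs at most one further \<open>ln n\<close>.\<close>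
  have "(x * ln 3 - ln 2) * real j \<le> (1 - H x) * ln 2 * real j"
    using H_le_ln4[OF x(1,2)] by (intro mult_right_mono) (auto simp: algebra_simps)
  also have "\<dots> \<le> ln (real n) + C * ln (real j + 1)"
    using ln_lower_bound[of j n] C_ln_le[of j] False assms by (simp add: x_def mult_ac)
  finally show ?thesis
    using ln_T_funpow_le[OF assms] by (simp add: x(3) algebra_simps)
qed (use assms in simp)

end

section \<open>From bounds in the number of steps to bounds in the starting value\<close>

theorem theorem4p1:
  assumes "LBH"
  shows "(\<exists>E :: nat \<Rightarrow> real. E \<in> O(\<lambda>n. ln (ln (real n))) \<and>
            (\<forall>n\<ge>2. ereal_of_enat (total_stopping_time n) \<le> ereal (\<gamma>_H * ln (real n) + E n)))
       \<and> (\<exists>E :: nat \<Rightarrow> real. E \<in> O(\<lambda>n. ln (ln (real n))) \<and>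
            (\<forall>n\<ge>2. ln_enat (max_excursion n) \<le> ereal (2 * ln (real n) + E n)))
       \<and> (\<exists>!r. is_r_H r)
       \<and> 0.609089 \<le> r_H \<and> r_H < 0.609090
       \<and> 41.677647655 \<le> \<gamma>_H \<and> \<gamma>_H < 41.677647656"
proof -
  from assms obtain C where "collatz_lower_bound C"
    unfolding LBH_def collatz_lower_bound_def by (metis less_trans nat_neq_iff zero_less_one)
  then interpret collatz_lower_bound C .
  obtain A where "A > 0" and A: "\<And>n j. n > 1 \<Longrightarrow> \<forall>i<j. (T ^^ i) n \<noteq> 1 \<Longrightarrow> real j \<le> A * ln (real n)"
    using steps_avoiding_1_bounded by blast
  \<comment> \<open>The error \<open>(C + 1) * ln (j + 1)\<close> at the largest possible
    \<open>j\<close>, namely \<open>A * ln n\<close>.\<close>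
  define E where "E = (\<lambda>n::nat. (C + 1) * ln (A * ln (real n) + 1))"
  have E_nonneg: "E n \<ge> 0" if "n > 1" for n
    using that C_nonneg \<open>A > 0\<close> by (simp add: E_def)
  have "(\<lambda>n::nat. ln (A * ln (real n) + 1)) \<in> O(\<lambda>n. ln (ln (real n)))"
    using \<open>A > 0\<close> by real_asymp
  then have E_bigo: "E \<in> O(\<lambda>n. ln (ln (real n)))"
    unfolding E_def by simp
  have ln_le_E: "(C + 1) * ln (real j + 1) \<le> E n"
    if "n > 1" "\<forall>i<j. (T ^^ i) n \<noteq> 1" for n j
    unfolding E_def using A[OF that] C_nonneg by (intro mult_left_mono) auto
  have stopping: "ereal_of_enat (total_stopping_time n) \<le> ereal (\<gamma>_H * ln (real n) + \<gamma>_H * E n)"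
    if n: "n > 1" for n
  proof -
    obtain s where s: "(T ^^ s) n = 1" "\<forall>i<s. (T ^^ i) n \<noteq> 1" using ex_first_hit[OF n] by blast
    have "total_stopping_time n \<le> enat s"
      unfolding total_stopping_time_def using s by (intro INF_lower) auto
    then have "ereal_of_enat (total_stopping_time n) \<le> ereal_of_enat (enat s)"
      by (simp only: ereal_of_enat_le_iff)
    also have "\<dots> = ereal (real s)" by simp
    also have "real s \<le> \<gamma>_H * (ln (real n) + (C + 1) * ln (real s + 1))"
      using n inj_on_before_first_hit[OF s] by (rule stopping_bound)
    also have "\<dots> \<le> \<gamma>_H * (ln (real n) + E n)"
      using ln_le_E[OF n s(2)] gamma_H_bounds by (intro mult_left_mono) auto
    finally show ?thesis by (simp add: algebra_simps)
  qed
  have excursion: "ln_enat (max_excursion n) \<le> ereal (2 * ln (real n) + E n)" if n: "n > 1" for n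
  proof -
    obtain s where s: "(T ^^ s) n = 1" "\<forall>i<s. (T ^^ i) n \<noteq> 1" using ex_first_hit[OF n] by blast
    define B where "B = exp (2 * ln (real n) + E n)"
    have le_B: "real ((T ^^ k) n) \<le> B" for k
    proof -
      have "ln (real ((T ^^ k) n)) \<le> 2 * ln (real n) + E n"
      \<comment> \<open>The case \<open>k = s\<close> belongs to the first part, since distinctness
        concerns only indices below \<open>k\<close>. Beyond \<open>s\<close> the trajectory stays
        in the cycle 1, 2, hence is at most \<open>n\<close>.\<close>
      proof (cases "k \<le> s")
        case True
        have "inj_on (\<lambda>i. (T ^^ i) n) {..<k}"
          by (rule inj_on_subset[OF inj_on_before_first_hit[OF s]]) (use True in auto)
        then have "ln (real ((T ^^ k) n)) \<le> 2 * ln (real n) + (C + 1) * ln (real k + 1)"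
          using n by (intro excursion_bound)
        also have "\<dots> \<le> 2 * ln (real n) + E n" using ln_le_E[of n k] n s True by auto
        finally show ?thesis .
      next
        case False
        then have "(T ^^ k) n = (T ^^ (k - s + s)) n" by simp
        also have "\<dots> = (T ^^ (k - s)) 1" by (simp only: funpow_add o_apply s(1))
        finally have "real ((T ^^ k) n) \<le> real n" using T_funpow_from_1[of "k - s"] n by simp
        then have "ln (real ((T ^^ k) n)) \<le> ln (real n)"
          using T_funpow_pos[of n k] n by (intro ln_mono) auto
        moreover have "0 \<le> ln (real n)" using n by simp
        ultimately show ?thesis using E_nonneg[OF n] by linarith
      qed
      then have "exp (ln (real ((T ^^ k) n))) \<le> B" by (simp only: B_def exp_le_cancel_iff)
      then show ?thesis using T_funpow_pos[of n k] n by simp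
    qed
    \<comment> \<open>Rounding the real bound down to a natural number shows that the supremum is
      finite.\<close>
    have "max_excursion n \<le> enat (nat \<lfloor>B\<rfloor>)"
      unfolding max_excursion_def by (intro SUP_least) (use le_B in \<open>simp add: le_nat_floor\<close>)
    then obtain m where m: "max_excursion n = enat m" "m \<le> nat \<lfloor>B\<rfloor>"
      by (cases "max_excursion n") auto
    have "enat ((T ^^ 0) n) \<le> max_excursion n"
      unfolding max_excursion_def by (rule SUP_upper) simp
    with m n have "m > 0" by simp
    have "real m \<le> B" using m(2) by (simp add: B_def le_nat_iff le_floor_iff)
    then have "ln (real m) \<le> ln B" using \<open>m > 0\<close> by (intro ln_mono) auto
    then show ?thesis by (simp add: m(1) ln_enat_def B_def)
  qed
  have "\<exists>!r. is_r_H r" using is_r_H_r_H is_r_H_unique by blast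
  moreover have "0.609089 \<le> r_H" "r_H < 0.609090"
    using r_H_between by (auto simp: r_lo_def r_hi_def)
  moreover have "(\<lambda>n. \<gamma>_H * E n) \<in> O(\<lambda>n. ln (ln (real n)))"
    using E_bigo by simp
  ultimately show ?thesis
    using gamma_H_bounds stopping excursion E_bigo by (intro conjI exI[of _ "\<lambda>n. \<gamma>_H * E n"] exI[of _ E]) auto
qed

end
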